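(* Let $\alpha,\beta,\gamma>-1$ with $\alpha-\beta\notin\mathbb Z$. If $|\alpha-\beta|<1$, then the Jacobi matrix $J$ of the monic Jacobi–Piñeiro multiple orthogonal polynomials of type II on the step-line is a nonnegative matrix, i.e. all its entries are $\ge0$.
   Context: The monic Jacobi–Piñeiro multiple orthogonal polynomials of type II $B_{(n,m)}$ are the monic polynomials of degree $n+m$ with $$\int_0^1B_{(n,m)}(x)x^{\alpha+j}(1-x)^\gamma\,dx=0,\ 0\le j\le n-1,\qquad\int_0^1B_{(n,m)}(x)x^{\beta+j}(1-x)^\gamma\,dx=0,\ 0\le j\le m-1.$$ On the step-line put $B^{(2n)}=B_{(n,n)}$ and $B^{(2n+1)}=B_{(n+1,n)}$, $n\in\mathbb N_0$. The Jacobi matrix $J=(J_{k,l})_{k,l\in\mathbb N_0}$ is defined by $xB^{(k)}(x)=\sum_lJ_{k,l}B^{(l)}(x)$; one has $J_{k,k+1}=1$ and $J_{k,l}=0$ unless $k-2\le l\le k+1$. *)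

theory Defs
  imports "HOL-Analysis.Analysis" "HOL-Computational_Algebra.Polynomial"
begin

text \<open>The real parameters \<open>\<alpha>, \<beta>, \<gamma>\<close> are meant to satisfy \<open>\<alpha>, \<beta>, \<gamma> > -1\<close> and \<open>\<alpha> - \<beta> \<notin> \<int>\<close>;
  only then are the definite descriptions below justified. Orthogonality is expressed by
  \<open>has_integral\<close>, so convergence of the (possibly improper) integrals is included; the
  values of \<open>powr\<close> at the end points of \<open>[0, 1]\<close> are irrelevant.\<close>

definition is_jacobi_pineiro ::
    "real \<Rightarrow> real \<Rightarrow> real \<Rightarrow> nat \<Rightarrow> nat \<Rightarrow> real poly \<Rightarrow> bool" where
  "is_jacobi_pineiro \<alpha> \<beta> \<gamma> n m p \<longleftrightarrow>
     degree p = n + m \<and> lead_coeff p = 1 \<and>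
     (\<forall>j<n. ((\<lambda>x. poly p x * x powr (\<alpha> + real j) * (1 - x) powr \<gamma>) has_integral 0) {0..1}) \<and>
     (\<forall>j<m. ((\<lambda>x. poly p x * x powr (\<beta> + real j) * (1 - x) powr \<gamma>) has_integral 0) {0..1})"

definition jacobi_pineiro :: "real \<Rightarrow> real \<Rightarrow> real \<Rightarrow> nat \<Rightarrow> nat \<Rightarrow> real poly" where
  "jacobi_pineiro \<alpha> \<beta> \<gamma> n m = (THE p. is_jacobi_pineiro \<alpha> \<beta> \<gamma> n m p)"

text \<open>The step-line: index \<open>2 * n\<close> gives the multi-index \<open>(n, n)\<close> and index \<open>2 * n + 1\<close>
  gives \<open>(n + 1, n)\<close>.\<close>

definition jp_step :: "real \<Rightarrow> real \<Rightarrow> real \<Rightarrow> nat \<Rightarrow> real poly" where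
  "jp_step \<alpha> \<beta> \<gamma> k = jacobi_pineiro \<alpha> \<beta> \<gamma> ((k + 1) div 2) (k div 2)"

text \<open>Row \<open>k\<close> of the Jacobi matrix is the unique finitely supported coefficient sequence
  of \<open>x B\<^sup>(\<^sup>k\<^sup>)(x)\<close> with respect to the basis of step-line polynomials; the band
  structure is a consequence and not part of the definition.\<close>

definition jp_jacobi_matrix :: "real \<Rightarrow> real \<Rightarrow> real \<Rightarrow> nat \<Rightarrow> nat \<Rightarrow> real" where
  "jp_jacobi_matrix \<alpha> \<beta> \<gamma> k =
     (THE c. finite {l. c l \<noteq> 0} \<and>
        [:0, 1:] * jp_step \<alpha> \<beta> \<gamma> k =
          (\<Sum>l | c l \<noteq> 0. smult (c l) (jp_step \<alpha> \<beta> \<gamma> l)))"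

end

theory Submission
  imports Defs
begin

text \<open>
  The integral of \<open>p(x) x\<^sup>s (1 - x)\<^sup>\<gamma>\<close> over \<open>[0, 1]\<close> is, for \<open>p\<close> of degree at most \<open>N\<close>, a factor without
  zeros times a polynomial in \<open>s\<close> of degree at most \<open>N\<close>, and \<open>p\<close> is determined by that polynomial.
  For the step-line polynomial \<open>B\<^sup>(\<^sup>k\<^sup>)\<close> orthogonality prescribes its zeros
  \<open>\<alpha>, \<beta>, \<alpha> + 1, \<beta> + 1, \<dots>\<close> (the first \<open>k\<close> of these numbers), and monicity prescribes its value at
  \<open>- \<gamma> - 1 - k\<close>. Since multiplication by \<open>x\<close> becomes the shift \<open>s \<mapsto> s + 1\<close>, the recurrence turns, after
  division by the common zeros, into an identity between cubic polynomials in \<open>s\<close>. Evaluating it at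
  four points gives the recurrence coefficients in closed form, and for \<open>\<bar>\<alpha> - \<beta>\<bar> < 1\<close> their
  nonnegativity follows from elementary inequalities between products of linear factors.
\<close>

section \<open>Elementary inequalities between products of linear factors\<close>

lemma prod_ratio_mono:
  fixes a v w :: real
  assumes "0 < v" "v \<le> w" "0 \<le> e"
  shows "(w + e) * v \<le> (v + e) * w"
proof -
  have "v * e \<le> w * e" using assms by (intro mult_right_mono) auto
  then show ?thesis by (simp add: algebra_simps)
qed

text \<open>None of the quotients \<open>t / (t + 2 + p)\<close>,
  \<open>(t + x) / (t + 1 + p)\<close> and \<open>(t + y) / (t + 1 + q)\<close> decreases when
  \<open>t\<close> grows by 1. The auxiliary factor \<open>t + 2 + p\<close> cancels the first
  denominator on the left but the shifted second one on the right, which is why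
  \<open>t + 1 + p\<close> turns into \<open>t + 3 + p\<close>.\<close>

lemma diagonal_ratio:
  fixes t :: real
  assumes "t > 0" "t + x > 0" "t + y > 0" "x \<le> p + 1" "y \<le> q + 1" "- 2 \<le> p"
  shows "t * (t + x) * (t + y) / ((t + 1 + p) * (t + 1 + q))
    \<le> (t + 1) * (t + 1 + x) * (t + 1 + y) / ((t + 3 + p) * (t + 2 + q))"
proof -
  have pos: "t + 1 + p > 0" "t + 1 + q > 0" "t + 2 + p > 0" using assms by linarith+
  have 1: "(t + x) / (t + 1 + p) \<le> (t + 1 + x) / (t + 2 + p)"
    using prod_ratio_mono[of "t+x" "t+1+p" 1] assms pos
    by (simp add: frac_le_eq divide_le_eq pos_le_divide_eq field_simps)
  have 2: "(t + y) / (t + 1 + q) \<le> (t + 1 + y) / (t + 2 + q)"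
    using prod_ratio_mono[of "t+y" "t+1+q" 1] assms pos
    by (simp add: field_simps)
  have 3: "t / (t + 2 + p) \<le> (t + 1) / (t + 3 + p)"
    using prod_ratio_mono[of "t" "t+2+p" 1] assms pos
    by (simp add: field_simps)
  have "t * (t + x) * (t + y) / ((t + 1 + p) * (t + 1 + q)) = 
     (t / (t + 2 + p)) * ((t + x) / (t + 1 + p)) * ((t + y) / (t + 1 + q)) * (t + 2 + p)"
    using pos by simp
  also have "\<dots> \<le> ((t + 1) / (t + 3 + p)) * ((t + 1 + x) / (t + 2 + p)) * ((t + 1 + y) / (t + 2 + q)) * (t + 2 + p)"
    using assms pos 1 2 3 by (intro mult_mono mult_nonneg_nonneg divide_nonneg_pos) auto
  also have "\<dots> = (t + 1) * (t + 1 + x) * (t + 1 + y) / ((t + 3 + p) * (t + 2 + q))"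
    using pos by simp
  finally show ?thesis .
qed

text \<open>Adding \<open>e\<close> enlarges a smaller number by a larger factor. This settles
  \<open>u\<close> against \<open>v\<close>, and it reduces \<open>(v + 1) * (v + 2)\<close> to
  \<open>m * (m + 1)\<close>, the extreme case under \<open>m \<le> v + 1\<close>, which the
  assumption on \<open>A\<close> and \<open>B\<close> covers.\<close>

lemma rising_ratio:
  fixes u v e :: real
  assumes "0 < u" "u \<le> v" "0 \<le> e" "0 < m" "m \<le> v + 1"
    and AB: "A * ((m + e) * (m + 1 + e)) \<le> B * (m * (m + 1))" "0 \<le> A" "0 \<le> B"
  shows "u * A * ((v + e) * (v + 1 + e) * (v + 2 + e)) \<le> (u + e) * B * (v * (v + 1) * (v + 2))"
proof -
  have v: "0 < v" using assms by linarith
  have 1: "(v + e) * u \<le> (u + e) * v" using prod_ratio_mono[of u v e] assms by simp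
  have "(v + 1 + e) * m \<le> (m + e) * (v + 1)" "(v + 2 + e) * (m + 1) \<le> (m + 1 + e) * (v + 2)"
    using prod_ratio_mono[of m "v + 1" e] prod_ratio_mono[of "m + 1" "v + 2" e] assms by linarith+
  then have "((v + 1 + e) * m) * ((v + 2 + e) * (m + 1)) \<le> ((m + e) * (v + 1)) * ((m + 1 + e) * (v + 2))"
    by (rule mult_mono) (use assms v in simp_all)
  then have "A * (((v + 1 + e) * m) * ((v + 2 + e) * (m + 1))) \<le> A * (((m + e) * (v + 1)) * ((m + 1 + e) * (v + 2)))"
    using AB by (intro mult_left_mono) auto
  also have "\<dots> = (A * ((m + e) * (m + 1 + e))) * ((v + 1) * (v + 2))" by algebra
  also have "\<dots> \<le> (B * (m * (m + 1))) * ((v + 1) * (v + 2))"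
    using AB v by (intro mult_right_mono) auto
  finally have "(A * ((v + 1 + e) * (v + 2 + e))) * (m * (m + 1)) \<le> (B * ((v + 1) * (v + 2))) * (m * (m + 1))"
    by (simp add: mult_ac)
  then have 2: "A * ((v + 1 + e) * (v + 2 + e)) \<le> B * ((v + 1) * (v + 2))"
    using assms by (simp add: mult_le_cancel_right)
  have "((v + e) * u) * (A * ((v + 1 + e) * (v + 2 + e))) \<le> ((u + e) * v) * (B * ((v + 1) * (v + 2)))"
    by (rule mult_mono[OF 1 2]) (use assms v in simp_all)
  then show ?thesis by (simp add: mult_ac)
qed

text \<open>Since \<open>u > 0\<close>, the lower bound on \<open>v\<close> gives
  \<open>2 * n - 1 \<le> v + 1\<close>, so that only an inequality in \<open>n\<close> and
  \<open>d\<close> remains.\<close>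

lemma even_rising_ratio:
  fixes n u v d :: real
  assumes "1 \<le> n" "0 < u" "u + 2 * n - 2 \<le> v" "0 \<le> d" "d < 1"
  shows "u * (n - d) * ((v + d) * (v + 1 + d) * (v + 2 + d)) \<le> (u + d) * (n + d) * (v * (v + 1) * (v + 2))"
proof -
  \<comment> \<open>This expression is the right side minus the left side of the next
    inequality.\<close>
  have "d * (4 * n * (n - 1) + n + (3 * n - 1) * d + d * d) \<ge> 0"
    using assms by (intro mult_nonneg_nonneg add_nonneg_nonneg) auto
  then have "(n - d) * ((2 * n - 1 + d) * (2 * n - 1 + 1 + d)) \<le> (n + d) * ((2 * n - 1) * (2 * n - 1 + 1))"
    by (simp add: algebra_simps)
  then show ?thesis
    using assms by (intro rising_ratio[where m = "2 * n - 1"]) auto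
qed

lemma odd_rising_ratio:
  fixes n u v e :: real
  assumes "1 \<le> n" "0 < u" "u + 2 * n - 1 \<le> v" "0 \<le> e" "e < 2"
  shows "u * (n * (n + 1 - e)) * ((v + e) * (v + 1 + e) * (v + 2 + e)) \<le> (u + e) * ((n + 1) * (n + e)) * (v * (v + 1) * (v + 2))"
proof -
  have "n * e * (4 * n * n + 3 * n + 1 + 3 * n * e + e * e) \<ge> 0"
    using assms by (intro mult_nonneg_nonneg add_nonneg_nonneg) auto
  then have "n * (n + 1 - e) * ((2 * n + e) * (2 * n + 1 + e)) \<le> (n + 1) * (n + e) * ((2 * n) * (2 * n + 1))"
    by (simp add: algebra_simps)
  then show ?thesis
    using assms by (intro rising_ratio[where m = "2 * n"]) auto
qed

section \<open>Interpolation of cubics\<close>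

lemma degree_lin3: "degree ([:a, 1:] * [:b, 1:] * [:c, 1:] :: real poly) \<le> 3"
  by (simp add: degree_mult_eq)

text \<open>Both sides are cubics, so agreement at \<open>p\<close>, \<open>q\<close>,
  \<open>l\<close> and \<open>l + 1\<close> suffices. The products are arranged triangularly: only
  the \<open>R\<close> term survives at \<open>l\<close>, only the \<open>d\<close> term at
  \<open>p\<close>, then \<open>c\<close> joins at \<open>q\<close> and \<open>b\<close> at
  \<open>l + 1\<close>.\<close>

lemma cubic_expansion:
  fixes W :: "real poly"
  assumes W: "degree W \<le> 3" and dist: "p \<noteq> q" "p > l + 1" "q > l + 1"
    and R: "poly W l = R * ((l - p) * (l - q) * (l - p'))"
    and d: "poly W p = d * ((p - l) * (p - l - 1) * (p - l - 2))"
    and c: "poly W q = c * ((q - p) * (q - l) * (q - l - 1)) + d * ((q - l) * (q - l - 1) * (q - l - 2))"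
    and b: "poly W (l + 1) = R * ((l + 1 - p) * (l + 1 - q) * (l + 1 - p')) + b * ((l + 1 - p) * (l + 1 - q))"
  shows "poly W s = R * ((s - p) * (s - q) * (s - p')) + b * ((s - p) * (s - q) * (s - l))
    + c * ((s - p) * (s - l) * (s - l - 1)) + d * ((s - l) * (s - l - 1) * (s - l - 2))"
proof -
  define V where "V = smult R ([:-p,1:] * [:-q,1:] * [:-p',1:]) + smult b ([:-p,1:] * [:-q,1:] * [:-l,1:])
    + smult c ([:-p,1:] * [:-l,1:] * [:-l-1,1:]) + smult d ([:-l,1:] * [:-l-1,1:] * [:-l-2,1:])"
  have V: "degree V \<le> 3" unfolding V_def
    by (intro degree_add_le order.trans[OF degree_smult_le] degree_lin3)
  have pV: "poly V s = R * ((s - p) * (s - q) * (s - p')) + b * ((s - p) * (s - q) * (s - l))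
    + c * ((s - p) * (s - l) * (s - l - 1)) + d * ((s - l) * (s - l - 1) * (s - l - 2))" for s
    unfolding V_def by (simp add: algebra_simps)
  have "W = V"
  proof (rule poly_eqI_degree[where A = "{p, q, l, l + 1}"])
    have "card {p, q, l, l + 1} = 4" using dist by simp
    then show "card {p, q, l, l + 1} > degree W" "card {p, q, l, l + 1} > degree V" using W V by simp_all
    show "poly W x = poly V x" if "x \<in> {p, q, l, l + 1}" for x
      using that unfolding pV by (auto simp: R d c b)
  qed
  then show ?thesis using pV by simp
qed

section \<open>The weighted integral as a polynomial in the exponent\<close>

text \<open>For \<open>i \<le> N\<close> this is the quotient
  \<open>pochhammer (s + 1) i / pochhammer (s + \<gamma> + 2) i\<close> of the Beta integrals with
  and without \<open>x ^ i\<close>, multiplied by the common denominator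
  \<open>pochhammer (s + \<gamma> + 2) N\<close>.\<close>

definition mellin_basis :: "real \<Rightarrow> nat \<Rightarrow> nat \<Rightarrow> real poly" where
  "mellin_basis \<gamma> N i = (\<Prod>j<i. [:1 + real j, 1:]) * (\<Prod>j=i..<N. [:\<gamma> + 2 + real j, 1:])"

text \<open>The integral of \<open>p(x) x\<^sup>s (1 - x)\<^sup>\<gamma>\<close>, as a polynomial in \<open>s\<close>, normalised by a factor that depends on \<open>N\<close>:
  passing from \<open>N\<close> to \<open>N + 1\<close> multiplies it by \<open>s + \<gamma> + 2 + N\<close>. It is only meaningful if
  \<open>degree p \<le> N\<close>; higher coefficients are ignored.\<close>
definition mellin :: "real \<Rightarrow> nat \<Rightarrow> real poly \<Rightarrow> real poly" where
  "mellin \<gamma> N p = (\<Sum>i\<le>N. smult (coeff p i) (mellin_basis \<gamma> N i))"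

lemma mellin_basis_Suc:
  "i \<le> N \<Longrightarrow> mellin_basis \<gamma> (Suc N) i = [:\<gamma> + 2 + real N, 1:] * mellin_basis \<gamma> N i"
  by (simp add: mellin_basis_def prod.atLeastLessThan_Suc mult_ac del: mult_pCons_left mult_pCons_right)

lemma mellin_basis_shift:
  "poly (mellin_basis \<gamma> (Suc N) (Suc i)) s = (s + 1) * poly (mellin_basis \<gamma> N i) (s + 1)"
proof -
  have "poly (mellin_basis \<gamma> (Suc N) (Suc i)) s
    = (\<Prod>j<Suc i. 1 + real j + s) * (\<Prod>j=Suc i..<Suc N. \<gamma> + 2 + real j + s)"
    by (simp add: mellin_basis_def poly_prod del: prod.lessThan_Suc prod.op_ivl_Suc)
  also have "\<dots> = ((1 + s) * (\<Prod>j<i. 1 + real j + (s + 1))) * (\<Prod>j=i..<N. \<gamma> + 2 + real j + (s + 1))"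
    unfolding prod.lessThan_Suc_shift prod.atLeast_Suc_lessThan_Suc_shift by (simp add: add_ac)
  also have "\<dots> = (s + 1) * poly (mellin_basis \<gamma> N i) (s + 1)"
    by (simp add: mellin_basis_def poly_prod add_ac)
  finally show ?thesis .
qed

lemma degree_mellin_basis:
  assumes "i \<le> N"
  shows "degree (mellin_basis \<gamma> N i) \<le> N"
proof -
  have "degree (\<Prod>j<i. [:1 + real j, 1:]) \<le> i"
    by (rule order.trans[OF degree_prod_sum_le]) simp_all
  moreover have "degree (\<Prod>j=i..<N. [:\<gamma> + 2 + real j, 1:]) \<le> N - i"
    by (rule order.trans[OF degree_prod_sum_le]) simp_all
  ultimately have "degree (mellin_basis \<gamma> N i) \<le> i + (N - i)"
    unfolding mellin_basis_def by (intro order.trans[OF degree_mult_le] add_mono)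
  then show ?thesis using assms by simp
qed

lemma degree_mellin: "degree (mellin \<gamma> N p) \<le> N"
  unfolding mellin_def
  by (intro degree_sum_le order.trans[OF degree_smult_le] degree_mellin_basis) auto

lemma mellin_add: "mellin \<gamma> N (p + q) = mellin \<gamma> N p + mellin \<gamma> N q"
  by (simp add: mellin_def smult_add_left sum.distrib)

lemma mellin_smult: "mellin \<gamma> N (smult c p) = smult c (mellin \<gamma> N p)"
  by (rule poly_eqI) (simp add: mellin_def coeff_sum sum_distrib_left mult_ac)

lemma mellin_diff: "mellin \<gamma> N (p - q) = mellin \<gamma> N p - mellin \<gamma> N q"
  by (simp add: mellin_def smult_diff_left sum_subtractf)

lemma mellin_Suc:
  assumes "degree p \<le> N"
  shows "mellin \<gamma> (Suc N) p = [:\<gamma> + 2 + real N, 1:] * mellin \<gamma> N p"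
proof -
  have "mellin \<gamma> (Suc N) p = (\<Sum>i\<le>N. smult (coeff p i) (mellin_basis \<gamma> (Suc N) i))"
    using assms by (simp add: mellin_def coeff_eq_0)
  also have "\<dots> = (\<Sum>i\<le>N. [:\<gamma> + 2 + real N, 1:] * smult (coeff p i) (mellin_basis \<gamma> N i))"
    by (intro sum.cong) (simp_all add: mellin_basis_Suc del: mult_pCons_left mult_pCons_right)
  finally show ?thesis by (simp only: mellin_def sum_distrib_left)
qed

text \<open>An extra \<open>x\<close> raises the exponent \<open>s\<close> by 1; the factor
  \<open>s + 1\<close> stems from the change of the normalising Beta factor.\<close>

lemma poly_mellin_mult_X:
  "poly (mellin \<gamma> (Suc N) ([:0, 1:] * p)) s = (s + 1) * poly (mellin \<gamma> N p) (s + 1)"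
  by (simp add: mellin_def sum.atMost_Suc_shift poly_sum mellin_basis_shift sum_distrib_left mult_ac
      del: sum.atMost_Suc)

text \<open>At this point all basis polynomials except the top one vanish, so the leading coefficient of \<open>p\<close>
  can be read off.\<close>
lemma poly_mellin_top:
  "poly (mellin \<gamma> N p) (- \<gamma> - 1 - real N) = coeff p N * (\<Prod>j<N. real j - \<gamma> - real N)"
proof -
  have 0: "poly (mellin_basis \<gamma> N i) (- \<gamma> - 1 - real N) = 0" if "i < N" for i
    using that by (cases N) (simp_all add: mellin_basis_Suc del: mult_pCons_left mult_pCons_right)
  have "poly (mellin \<gamma> N p) (- \<gamma> - 1 - real N)
    = (\<Sum>i\<in>insert N {..<N}. coeff p i * poly (mellin_basis \<gamma> N i) (- \<gamma> - 1 - real N))"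
    by (simp add: mellin_def poly_sum ivl_disj_un_singleton flip: lessThan_Suc_atMost lessThan_Suc)
  also have "\<dots> = coeff p N * poly (mellin_basis \<gamma> N N) (- \<gamma> - 1 - real N)"
    by (simp add: 0)
  also have "poly (mellin_basis \<gamma> N N) (- \<gamma> - 1 - real N) = (\<Prod>j<N. real j - \<gamma> - real N)"
    by (simp add: mellin_basis_def poly_prod algebra_simps)
  finally show ?thesis .
qed

lemma top_factor_neg: "\<gamma> > -1 \<Longrightarrow> j < N \<Longrightarrow> real j - \<gamma> - real N < 0"
  by (auto dest!: Suc_leI simp flip: of_nat_le_iff[where 'a = real])

lemma top_prod_nonzero: "\<gamma> > -1 \<Longrightarrow> (\<Prod>j<N. real j - \<gamma> - real N) \<noteq> 0"
  by (subst prod_zero_iff) (use top_factor_neg in force)+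

text \<open>Injectivity: the value at \<open>- \<gamma> - 1 - real N\<close> forces the top
  coefficient to vanish, after which a linear factor cancels and \<open>N\<close> drops by
  1.\<close>

lemma mellin_eq_0:
  assumes "\<gamma> > -1" "degree p \<le> N" "mellin \<gamma> N p = 0"
  shows "p = 0"
  using assms(2,3)
proof (induction N)
  case 0
  then have "coeff p 0 = 0" using poly_mellin_top[of \<gamma> 0 p] by simp
  with 0 show ?case by (auto elim!: degree_eq_zeroE)
next
  case (Suc N)
  have "coeff p (Suc N) = 0"
    using poly_mellin_top[of \<gamma> "Suc N" p] top_prod_nonzero[OF assms(1), of "Suc N"] Suc.prems
    by (simp del: prod.lessThan_Suc)
  then have deg: "degree p \<le> N"
    using Suc.prems(1) by (metis le_SucE leading_coeff_0_iff degree_0 le0)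
  have "mellin \<gamma> N p = 0"
    using Suc.prems(2) unfolding mellin_Suc[OF deg] mult_eq_0_iff by simp
  then show ?case by (rule Suc.IH[OF deg])
qed

text \<open>Surjectivity, from which the existence of the orthogonal polynomials will follow. Once
  the right monomial is subtracted, the rest is divisible by the linear factor that separates
  \<open>N\<close> from \<open>Suc N\<close>.\<close>

lemma mellin_surj:
  assumes "\<gamma> > -1" "degree P \<le> N"
  shows "\<exists>p. degree p \<le> N \<and> mellin \<gamma> N p = P"
  using assms(2)
proof (induction N arbitrary: P)
  case 0
  then show ?case by (intro exI[of _ P]) (auto simp: mellin_def mellin_basis_def elim!: degree_eq_zeroE)
next
  case (Suc N)
  let ?l = "- \<gamma> - 1 - real (Suc N)"
  \<comment> \<open>By \<open>poly_mellin_top\<close> this is the only possible top coefficient of a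
    preimage.\<close>
  define a where "a = poly P ?l / (\<Prod>j<Suc N. real j - \<gamma> - real (Suc N))"
  define Q where "Q = P - mellin \<gamma> (Suc N) (monom a (Suc N))"
  have "poly Q ?l = 0"
    using top_prod_nonzero[OF assms(1), of "Suc N"]
    unfolding Q_def a_def poly_diff poly_mellin_top by (simp del: prod.lessThan_Suc)
  then obtain S where S: "Q = [:\<gamma> + 2 + real N, 1:] * S"
    unfolding poly_eq_0_iff_dvd
  proof (elim dvdE)
    fix S assume "Q = [:- ?l, 1:] * S"
    moreover have "- ?l = \<gamma> + 2 + real N" by simp
    ultimately show thesis by (intro that[of S]) (simp only:)
  qed
  have "degree Q \<le> Suc N" unfolding Q_def
    by (intro degree_diff_le Suc.prems degree_mellin)
  then have "degree S \<le> N"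
    unfolding S by (cases "S = 0") (simp_all add: degree_mult_eq del: mult_pCons_left)
  from Suc.IH[OF this] obtain p where p: "degree p \<le> N" "mellin \<gamma> N p = S" by blast
  have "mellin \<gamma> (Suc N) (p + monom a (Suc N)) = P"
    using mellin_Suc[OF p(1), of \<gamma>] p(2) S unfolding Q_def mellin_add by simp
  moreover have "degree (p + monom a (Suc N)) \<le> Suc N"
    using p(1) by (intro degree_add_le degree_monom_le) auto
  ultimately show ?case by blast
qed

section \<open>Beta integrals and the orthogonality conditions\<close>

lemma Beta_add_of_nat:
  fixes x y :: real
  assumes "x > 0" "y > 0"
  shows "pochhammer (x + y) i * Beta (x + real i) y = pochhammer x i * Beta x y"
proof (induction i)
  case (Suc i)
  have "x + real i \<notin> \<int>\<^sub>\<le>\<^sub>0" using assms by (auto elim!: nonpos_Ints_cases)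
  from Beta_plus1_left[OF this, of y] have
    *: "(x + y + real i) * Beta (x + real (Suc i)) y = (x + real i) * Beta (x + real i) y"
    by (simp add: add_ac)
  have "pochhammer (x + y) (Suc i) * Beta (x + real (Suc i)) y
    = pochhammer (x + y) i * ((x + y + real i) * Beta (x + real (Suc i)) y)"
    by (simp add: pochhammer_Suc)
  also have "\<dots> = (x + real i) * (pochhammer (x + y) i * Beta (x + real i) y)"
    unfolding * by simp
  also have "\<dots> = pochhammer x (Suc i) * Beta x y"
    unfolding Suc by (simp add: pochhammer_Suc)
  finally show ?case .
qed simp

lemma poly_mellin_basis:
  assumes "i \<le> N"
  shows "poly (mellin_basis \<gamma> N i) s * pochhammer (s + \<gamma> + 2) i
    = pochhammer (s + 1) i * pochhammer (s + \<gamma> + 2) N"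
proof -
  have "pochhammer (s + \<gamma> + 2) N = (\<Prod>j<i. s + \<gamma> + 2 + real j) * (\<Prod>j=i..<N. s + \<gamma> + 2 + real j)"
    using assms unfolding pochhammer_prod lessThan_atLeast0
    by (subst prod.atLeastLessThan_concat) simp_all
  then show ?thesis
    by (simp add: mellin_basis_def poly_prod pochhammer_prod atLeast0LessThan add_ac mult_ac)
qed

text \<open>The monomials of \<open>p\<close> are integrated separately as Beta integrals;
  \<open>Beta_add_of_nat\<close> brings them to a common prefactor.\<close>

lemma has_integral_mellin:
  assumes "s > -1" "\<gamma> > -1" "degree p \<le> N"
  shows "((\<lambda>x. poly p x * x powr s * (1 - x) powr \<gamma>) has_integral
    Beta (s + 1) (\<gamma> + 1) / pochhammer (s + \<gamma> + 2) N * poly (mellin \<gamma> N p) s) {0..1}"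
proof -
  have ph: "pochhammer (s + \<gamma> + 2) i \<noteq> 0" for i
    using assms pochhammer_pos[of "s + \<gamma> + 2" i] by linarith
  have int: "((\<lambda>x. x powr (s + real i) * (1 - x) powr \<gamma>) has_integral
    Beta (s + 1) (\<gamma> + 1) / pochhammer (s + \<gamma> + 2) N * poly (mellin_basis \<gamma> N i) s) {0..1}"
    if "i \<le> N" for i
  proof -
    have "Beta (s + 1 + real i) (\<gamma> + 1)
      = Beta (s + 1) (\<gamma> + 1) / pochhammer (s + \<gamma> + 2) N * poly (mellin_basis \<gamma> N i) s"
      (is "?B = _ * ?M")
    proof -
      have "?B = pochhammer (s + 1) i * Beta (s + 1) (\<gamma> + 1) / pochhammer (s + \<gamma> + 2) i"
        using Beta_add_of_nat[of "s + 1" "\<gamma> + 1" i] ph[of i] assms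
        by (simp add: nonzero_eq_divide_eq add_ac mult.commute)
      moreover have "?M = pochhammer (s + 1) i * pochhammer (s + \<gamma> + 2) N / pochhammer (s + \<gamma> + 2) i"
        using poly_mellin_basis[OF that, of \<gamma> s] ph[of i] by (simp add: nonzero_eq_divide_eq)
      ultimately show ?thesis using ph[of N] by simp
    qed
    then show ?thesis
      using has_integral_Beta_real[of "s + 1 + real i" "\<gamma> + 1"] assms by (simp add: add_ac)
  qed
  have "((\<lambda>x. \<Sum>i\<le>N. coeff p i * (x powr (s + real i) * (1 - x) powr \<gamma>)) has_integral
    (\<Sum>i\<le>N. coeff p i * (Beta (s + 1) (\<gamma> + 1) / pochhammer (s + \<gamma> + 2) N * poly (mellin_basis \<gamma> N i) s))) {0..1}"
    by (intro has_integral_sum has_integral_mult_right int) auto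
  also have "(\<Sum>i\<le>N. coeff p i * (Beta (s + 1) (\<gamma> + 1) / pochhammer (s + \<gamma> + 2) N * poly (mellin_basis \<gamma> N i) s))
    = Beta (s + 1) (\<gamma> + 1) / pochhammer (s + \<gamma> + 2) N * poly (mellin \<gamma> N p) s"
    by (simp add: mellin_def poly_sum sum_distrib_left sum_divide_distrib mult_ac)
  finally show ?thesis
  proof (rule has_integral_eq[rotated])
    fix x :: real assume "x \<in> {0..1}"
    \<comment> \<open>At \<open>x = 0\<close> both sides vanish because \<open>0 powr a = 0\<close>
      for every exponent, even a negative one.\<close>
    then have pw: "x powr (s + real i) = x ^ i * x powr s" for i
      by (cases "x = 0") (auto simp: powr_add powr_realpow)
    have "poly p x = (\<Sum>i\<le>N. coeff p i * x ^ i)"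
      unfolding poly_altdef using assms(3)
      by (intro sum.mono_neutral_left) (auto simp: coeff_eq_0)
    then show "(\<Sum>i\<le>N. coeff p i * (x powr (s + real i) * (1 - x) powr \<gamma>))
      = poly p x * x powr s * (1 - x) powr \<gamma>"
      by (simp add: pw sum_distrib_right sum_distrib_left mult_ac)
  qed
qed

text \<open>The prefactor has no zeros, so an orthogonality condition amounts to a zero of the
  transform.\<close>

lemma has_integral_0_iff_mellin:
  assumes "s > -1" "\<gamma> > -1" "degree p \<le> N"
  shows "((\<lambda>x. poly p x * x powr s * (1 - x) powr \<gamma>) has_integral 0) {0..1}
    \<longleftrightarrow> poly (mellin \<gamma> N p) s = 0"
proof -
  have "Beta (s + 1) (\<gamma> + 1) \<noteq> 0"
    using assms by (simp add: Beta_def Gamma_eq_zero_iff)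
      (auto simp: rGamma_eq_zero_iff elim!: nonpos_Ints_cases)
  moreover have "pochhammer (s + \<gamma> + 2) N \<noteq> 0"
    using assms pochhammer_pos[of "s + \<gamma> + 2" N] by linarith
  ultimately have "Beta (s + 1) (\<gamma> + 1) / pochhammer (s + \<gamma> + 2) N * y = 0 \<longleftrightarrow> y = 0" for y
    by simp
  then show ?thesis
    using has_integral_mellin[OF assms] has_integral_unique by metis
qed

section \<open>Nonnegative coefficients in the cubic identity\<close>

text \<open>Solving the triangular system of \<open>cubic_expansion\<close> expresses
  \<open>d\<close>, \<open>c\<close> and \<open>b\<close> explicitly; \<open>d0\<close>,
  \<open>c0\<close> and \<open>b0\<close> are their signs after multiplication by positive
  quantities and, for \<open>c0\<close>, by the square of \<open>q - p\<close>.\<close>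

lemma cubic_expansion_nonneg:
  fixes \<alpha> \<beta> p q t R :: real
  assumes t: "t > 1" and pq: "p > -1" "q > -1" "p \<noteq> q"
    and R: "(t + 1) * (t + 1 + \<alpha>) * (t + 1 + \<beta>) = R * ((t + 2 + p) * (t + 2 + q) * (t + 3 + p))"
    and d0: "0 \<le> (p + 1) * (p + 1 - \<alpha>) * (p + 1 - \<beta>)"
    and c0: "0 \<le> (q - p) * ((q + 1) * (q + 1 - \<alpha>) * (q + 1 - \<beta>) * ((p + t) * (p + t + 1) * (p + t + 2))
      - (p + 1) * (p + 1 - \<alpha>) * (p + 1 - \<beta>) * ((q + t) * (q + t + 1) * (q + t + 2)))"
    and b0: "t * (t + \<alpha>) * (t + \<beta>) / ((t + 1 + p) * (t + 1 + q))
      \<le> (t + 1) * (t + 1 + \<alpha>) * (t + 1 + \<beta>) / ((t + 3 + p) * (t + 2 + q))"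
  obtains b c d where "0 \<le> b" "0 \<le> c" "0 \<le> d"
    "\<And>s. (s + 1) * (s + 1 - \<alpha>) * (s + 1 - \<beta>) = R * ((s - p) * (s - q) * (s - (p + 1)))
      + b * ((s - p) * (s - q) * (s + t + 2)) + c * ((s - p) * (s + t + 2) * (s + t + 1))
      + d * ((s + t + 2) * (s + t + 1) * (s + t))"
proof -
  define w where "w s = (s + 1) * (s + 1 - \<alpha>) * (s + 1 - \<beta>)" for s
  define W where "W = [:1, 1:] * [:1 - \<alpha>, 1:] * [:1 - \<beta>, 1:]"
  have W: "poly W s = w s" for s unfolding W_def w_def by (simp add: algebra_simps)
  define x where "x s = (s + t) * (s + t + 1) * (s + t + 2)" for s
  \<comment> \<open>The zero of the factor \<open>s + t + 2\<close>; the other two factors vanish at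
    \<open>l + 1\<close> and \<open>l + 2\<close>.\<close>
  define l where "l = - t - 2"
  have x: "x s = (s - l) * (s - l - 1) * (s - l - 2)" for s
    unfolding x_def l_def by (simp add: algebra_simps)
  have pos: "x p > 0" "x q > 0" "t + 1 + p > 0" "t + 1 + q > 0" "t + 2 + p > 0" "t + 2 + q > 0" "t + 3 + p > 0"
    using t pq unfolding x_def by (auto intro!: mult_pos_pos)
  define d where "d = w p / x p"
  define c where "c = (w q - d * x q) / ((q - p) * ((q - l) * (q - l - 1)))"
  define b where "b = R * (t + 2 + p) - t * (t + \<alpha>) * (t + \<beta>) / ((t + 1 + p) * (t + 1 + q))"
  have ql: "(q - l) * (q - l - 1) > 0" unfolding l_def using t pq by (intro mult_pos_pos) auto
  have d: "0 \<le> d" using d0 pos unfolding d_def w_def by simp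
  have "0 \<le> (q - p) * (w q * x p - w p * x q) / x p"
    using c0 pos unfolding w_def x_def by (intro divide_nonneg_pos)
  also have "\<dots> = (q - p) * (w q - d * x q)"
    using pos unfolding d_def by (simp add: field_simps)
  finally have "0 \<le> (w q - d * x q) / (q - p)"
    using pq by (simp add: zero_le_divide_iff zero_le_mult_iff) linarith
  then have "0 \<le> (w q - d * x q) / (q - p) / ((q - l) * (q - l - 1))"
    using ql by (rule divide_nonneg_pos)
  then have c: "0 \<le> c" unfolding c_def by simp
  have "R * (t + 2 + p) = (t + 1) * (t + 1 + \<alpha>) * (t + 1 + \<beta>) / ((t + 3 + p) * (t + 2 + q))"
    unfolding R using pos by simp
  then have b: "0 \<le> b" using b0 unfolding b_def by simp
  have "poly W s = R * ((s - p) * (s - q) * (s - (p + 1))) + b * ((s - p) * (s - q) * (s - l))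
    + c * ((s - p) * (s - l) * (s - l - 1)) + d * ((s - l) * (s - l - 1) * (s - l - 2))" for s
  proof (rule cubic_expansion)
    show "degree W \<le> 3" unfolding W_def by (rule degree_lin3)
    show "p \<noteq> q" "l + 1 < p" "l + 1 < q" unfolding l_def using t pq by auto
    have "poly W l = - ((t + 1) * (t + 1 + \<alpha>) * (t + 1 + \<beta>))"
      unfolding W w_def l_def by algebra
    also have "\<dots> = R * ((l - p) * (l - q) * (l - (p + 1)))"
      unfolding R l_def by algebra
    finally show "poly W l = R * ((l - p) * (l - q) * (l - (p + 1)))" .
    show "poly W p = d * ((p - l) * (p - l - 1) * (p - l - 2))"
      using pos unfolding W d_def x[symmetric] by simp
    have "c * ((q - p) * ((q - l) * (q - l - 1))) = w q - d * x q"
      unfolding c_def using ql pq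
      by (intro nonzero_eq_divide_eq[THEN iffD1] refl) (metis less_irrefl mult_eq_0_iff right_minus_eq)
    then show "poly W q = c * ((q - p) * (q - l) * (q - l - 1)) + d * ((q - l) * (q - l - 1) * (q - l - 2))"
      unfolding W x[symmetric] by (simp add: mult.assoc)
    have "b * ((l + 1 - p) * (l + 1 - q)) = b * ((t + 1 + p) * (t + 1 + q))"
      unfolding l_def by algebra
    also have "\<dots> = R * (t + 2 + p) * ((t + 1 + p) * (t + 1 + q)) - t * (t + \<alpha>) * (t + \<beta>)"
      using pos unfolding b_def left_diff_distrib by simp
    also have "\<dots> = w (l + 1) - R * ((l + 1 - p) * (l + 1 - q) * (l + 1 - (p + 1)))"
      unfolding l_def w_def by algebra
    finally show "poly W (l + 1) = R * ((l + 1 - p) * (l + 1 - q) * (l + 1 - (p + 1))) + b * ((l + 1 - p) * (l + 1 - q))"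
      unfolding W by simp
  qed
  note expansion = this
  have shift: "s - l = s + t + 2" "s + t + 2 - 1 = s + t + 1" "s + t + 2 - 2 = s + t" for s
    by (simp_all add: l_def)
  show thesis
    by (rule that[OF b c d]) (use expansion in \<open>unfold W w_def shift\<close>)
qed

section \<open>Step-line polynomials and their transforms\<close>

locale jp_params =
  fixes \<alpha> \<beta> \<gamma> :: real
  assumes gt: "\<alpha> > -1" "\<beta> > -1" "\<gamma> > -1" and nonint: "\<alpha> - \<beta> \<notin> \<int>"
begin

text \<open>The zeros \<open>\<alpha>, \<beta>, \<alpha> + 1, \<beta> + 1, \<dots>\<close>; the constant \<open>C k\<close> is the one that makes the polynomial
  with transform \<open>C k * Z k\<close> monic.\<close>
definition z :: "nat \<Rightarrow> real" where
  "z i = (if even i then \<alpha> else \<beta>) + real (i div 2)"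

definition Z :: "nat \<Rightarrow> real poly" where
  "Z k = (\<Prod>i<k. [:- z i, 1:])"

definition C :: "nat \<Rightarrow> real" where
  "C k = (\<Prod>j<k. (\<gamma> + real k - real j) / (\<gamma> + 1 + real k + z j))"

abbreviation B :: "nat \<Rightarrow> real poly" where
  "B \<equiv> jp_step \<alpha> \<beta> \<gamma>"

lemma z_simps [simp]: "z 0 = \<alpha>" "z (Suc 0) = \<beta>" "z (Suc (Suc i)) = z i + 1"
  by (simp_all add: z_def)

lemma z_gt: "z i > -1"
  using gt by (simp add: z_def add_strict_increasing2 add.commute)

text \<open>The assumption \<open>nonint\<close> separates the zeros of the two families.\<close>

lemma inj_z: "inj z"
proof (rule injI)
  fix i j assume eq: "z i = z j"
  have "even i = even j"
  proof (rule ccontr)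
    assume "even i \<noteq> even j"
    then have "\<alpha> - \<beta> = real (j div 2) - real (i div 2) \<or> \<alpha> - \<beta> = real (i div 2) - real (j div 2)"
      using eq by (auto simp: z_def split: if_splits)
    then show False using nonint by (metis Ints_diff Ints_of_nat)
  qed
  moreover have "i div 2 = j div 2"
    using eq calculation by (auto simp: z_def split: if_splits)
  ultimately show "i = j" by presburger
qed

lemma poly_Z: "poly (Z k) s = (\<Prod>i<k. s - z i)"
  by (simp add: Z_def poly_prod)

lemma Z_root: "i < k \<Longrightarrow> poly (Z k) (z i) = 0"
  by (auto simp: poly_Z)

lemma degree_Z: "degree (Z k) \<le> k"
  unfolding Z_def by (rule order.trans[OF degree_prod_sum_le]) simp_all

text \<open>Since \<open>z (Suc (Suc i)) = z i + 1\<close>, the shift loses only the two initial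
  zeros. Hence \<open>Z k\<close> is a common factor of the recurrence.\<close>

lemma poly_Z_shift: "poly (Z (Suc (Suc k))) (s + 1) = (s + 1 - \<alpha>) * (s + 1 - \<beta>) * poly (Z k) s"
  by (simp add: poly_Z prod.lessThan_Suc_shift del: prod.lessThan_Suc)

lemma C_pos: "C k > 0"
  unfolding C_def
proof (rule prod_pos, intro divide_pos_pos)
  fix j assume "j \<in> {..<k}"
  then have "real j + 1 \<le> real k" by simp
  then show "0 < \<gamma> + real k - real j" "0 < \<gamma> + 1 + real k + z j"
    using gt z_gt[of j] by linarith+
qed

lemma Z_neg_nonzero: "s \<le> -1 \<Longrightarrow> poly (Z k) s \<noteq> 0"
  using z_gt by (auto simp: poly_Z less_le_not_le)

text \<open>This is the value that \<open>poly_mellin_top\<close> prescribes for top coefficient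
  1.\<close>

lemma C_Z_top: "C k * poly (Z k) (- \<gamma> - 1 - real k) = (\<Prod>j<k. real j - \<gamma> - real k)"
proof -
  have *: "\<gamma> + 1 + real k + z j \<noteq> 0" if "j < k" for j
  proof -
    from that have "real j + 1 \<le> real k" by simp
    then show ?thesis using gt z_gt[of j] by linarith
  qed
  have "C k * poly (Z k) (- \<gamma> - 1 - real k)
    = (\<Prod>j<k. (\<gamma> + real k - real j) / (\<gamma> + 1 + real k + z j) * (- \<gamma> - 1 - real k - z j))"
    by (simp only: C_def poly_Z prod.distrib)
  also have "\<dots> = (\<Prod>j<k. real j - \<gamma> - real k)"
  proof (intro prod.cong refl)
    fix j assume "j \<in> {..<k}"
    then have "x / (\<gamma> + 1 + real k + z j) * - (\<gamma> + 1 + real k + z j) = - x" for x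
      using *[of j] by (simp del: minus_add_distrib)
    from this[of "\<gamma> + real k - real j"]
    show "(\<gamma> + real k - real j) / (\<gamma> + 1 + real k + z j) * (- \<gamma> - 1 - real k - z j) = real j - \<gamma> - real k"
      by simp
  qed
  finally show ?thesis .
qed

text \<open>The conditions with \<alpha> go to the even indices of \<open>z\<close>, those with
  \<beta> to the odd ones.\<close>

lemma is_jacobi_pineiro_step_iff:
  "is_jacobi_pineiro \<alpha> \<beta> \<gamma> ((k + 1) div 2) (k div 2) p \<longleftrightarrow>
    degree p = k \<and> lead_coeff p = 1 \<and> (\<forall>i<k. poly (mellin \<gamma> k p) (z i) = 0)"
proof -
  have k: "(k + 1) div 2 + k div 2 = k" by presburger
  have *: "(\<forall>i<k. P (z i)) \<longleftrightarrow>
    (\<forall>j<(k + 1) div 2. P (\<alpha> + real j)) \<and> (\<forall>j<k div 2. P (\<beta> + real j))" (is "?l \<longleftrightarrow> ?r") for P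
  proof
    assume l: ?l
    show ?r
    proof (intro conjI allI impI)
      fix j assume "j < (k + 1) div 2"
      then have "2 * j < k" by linarith
      then show "P (\<alpha> + real j)" using l[rule_format, of "2 * j"] by (simp add: z_def)
    next
      fix j assume "j < k div 2"
      then have "2 * j + 1 < k" by linarith
      then show "P (\<beta> + real j)" using l[rule_format, of "2 * j + 1"] by (simp add: z_def)
    qed
  next
    assume r: ?r
    show ?l
    proof (intro allI impI)
      fix i assume "i < k"
      then have "i div 2 < (k + 1) div 2" "odd i \<Longrightarrow> i div 2 < k div 2" by presburger+
      then show "P (z i)" using r by (auto simp: z_def)
    qed
  qed
  have **: "\<alpha> + real j > -1" "\<beta> + real j > -1" for j using gt by (simp_all add: add_strict_increasing)
  \<comment> \<open>The integral criterion requires degree at most \<open>k\<close>; if the degree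
    is not \<open>k\<close>, both sides are false.\<close>
  show ?thesis
    unfolding is_jacobi_pineiro_def k
    by (cases "degree p = k")
      (use *[of "\<lambda>s. poly (mellin \<gamma> k p) s = 0"] in \<open>simp_all add: ** gt has_integral_0_iff_mellin[where N = k]\<close>)
qed

text \<open>Two polynomials of degree at most \<open>k\<close> agree at \<open>k + 1\<close> points:
  the \<open>k\<close> prescribed zeros and the point where the leading coefficient is read
  off.\<close>

lemma mellin_step_eq:
  assumes "degree p = k" "lead_coeff p = 1" "\<forall>i<k. poly (mellin \<gamma> k p) (z i) = 0"
  shows "mellin \<gamma> k p = smult (C k) (Z k)"
proof (rule poly_eqI_degree)
  let ?l = "- \<gamma> - 1 - real k"
  have l: "?l \<notin> z ` {..<k}"
  proof
    assume "?l \<in> z ` {..<k}"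
    then obtain i where "i < k" "z i = ?l" by auto
    moreover from this have "real i + 1 \<le> real k" by simp
    ultimately show False using z_gt[of i] gt by linarith
  qed
  have "card (insert ?l (z ` {..<k})) = Suc k"
    using l inj_z by (simp add: card_image inj_on_subset[OF inj_z])
  then show "degree (mellin \<gamma> k p) < card (insert ?l (z ` {..<k}))"
    "degree (smult (C k) (Z k)) < card (insert ?l (z ` {..<k}))"
    using degree_mellin[of \<gamma> k p] degree_Z[of k] C_pos[of k] by auto
  fix s assume "s \<in> insert ?l (z ` {..<k})"
  then show "poly (mellin \<gamma> k p) s = poly (smult (C k) (Z k)) s"
  proof
    assume "s = ?l"
    then show ?thesis using poly_mellin_top[of \<gamma> k p] assms C_Z_top[of k] by simp
  next
    assume "s \<in> z ` {..<k}"
    then show ?thesis using assms(3) by (auto simp: Z_root)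
  qed
qed

lemma ex1_jacobi_pineiro_step: "\<exists>!p. is_jacobi_pineiro \<alpha> \<beta> \<gamma> ((k + 1) div 2) (k div 2) p"
proof (rule ex_ex1I)
  have "degree (smult (C k) (Z k)) \<le> k" using degree_Z by (rule order.trans[OF degree_smult_le])
  then obtain p where p: "degree p \<le> k" "mellin \<gamma> k p = smult (C k) (Z k)"
    using mellin_surj gt by blast
  have "coeff p k = 1"
    using poly_mellin_top[of \<gamma> k p] C_Z_top[of k] top_prod_nonzero[of \<gamma> k] gt p by simp
  moreover from this have "degree p = k" using p(1) by (intro antisym le_degree) auto
  ultimately have "is_jacobi_pineiro \<alpha> \<beta> \<gamma> ((k + 1) div 2) (k div 2) p"
    unfolding is_jacobi_pineiro_step_iff p(2) by (simp add: Z_root)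
  then show "\<exists>p. is_jacobi_pineiro \<alpha> \<beta> \<gamma> ((k + 1) div 2) (k div 2) p" ..
next
  fix p p'
  assume "is_jacobi_pineiro \<alpha> \<beta> \<gamma> ((k + 1) div 2) (k div 2) p"
    "is_jacobi_pineiro \<alpha> \<beta> \<gamma> ((k + 1) div 2) (k div 2) p'"
  then have p: "degree p = k" "degree p' = k" "mellin \<gamma> k p = smult (C k) (Z k)" "mellin \<gamma> k p' = smult (C k) (Z k)"
    unfolding is_jacobi_pineiro_step_iff by (auto intro: mellin_step_eq)
  have "mellin \<gamma> k (p - p') = 0" unfolding mellin_diff p(3,4) by simp
  moreover have "degree (p - p') \<le> k" by (rule degree_diff_le) (simp_all add: p(1,2))
  ultimately have "p - p' = 0" using mellin_eq_0[OF gt(3)] by blast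
  then show "p = p'" by simp
qed

lemma jp_step_props:
  shows degree_B: "degree (B k) = k" and coeff_B: "coeff (B k) k = 1"
    and mellin_B: "mellin \<gamma> k (B k) = smult (C k) (Z k)"
proof -
  have *: "is_jacobi_pineiro \<alpha> \<beta> \<gamma> ((k + 1) div 2) (k div 2) (B k)"
    unfolding jp_step_def jacobi_pineiro_def by (rule theI') (rule ex1_jacobi_pineiro_step)
  then show "degree (B k) = k" unfolding is_jacobi_pineiro_step_iff by simp
  with * show "coeff (B k) k = 1" unfolding is_jacobi_pineiro_step_iff by auto
  from * show "mellin \<gamma> k (B k) = smult (C k) (Z k)"
    unfolding is_jacobi_pineiro_step_iff by (auto intro: mellin_step_eq)
qed

lemma poly_mellin_X_B:
  "poly (mellin \<gamma> (Suc k) ([:0, 1:] * B k)) s = (s + 1) * C k * poly (Z k) (s + 1)"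
  unfolding poly_mellin_mult_X mellin_B by simp

text \<open>Both \<open>x B\<^sup>(\<^sup>k\<^sup>)\<close> and the next step-line polynomial have
  top coefficient 1, so their transforms agree at this point. This relates consecutive constants
  without manipulating the product in \<open>C\<close>.\<close>

lemma C_Suc: "C (Suc k) * poly (Z (Suc k)) (- \<gamma> - 2 - real k)
  = (- \<gamma> - 1 - real k) * C k * poly (Z k) (- \<gamma> - 1 - real k)"
proof -
  have "poly (mellin \<gamma> (Suc k) ([:0, 1:] * B k)) (- \<gamma> - 1 - real (Suc k))
    = poly (mellin \<gamma> (Suc k) (B (Suc k))) (- \<gamma> - 1 - real (Suc k))"
    unfolding poly_mellin_top by (simp add: coeff_B)
  moreover have "- \<gamma> - 1 - real (Suc k) = - \<gamma> - 2 - real k"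
    "- \<gamma> - 2 - real k + 1 = - \<gamma> - 1 - real k" by simp_all
  ultimately show ?thesis unfolding poly_mellin_X_B mellin_B by (simp only: poly_smult)
qed

text \<open>All terms of a recurrence have to be transformed with the same \<open>N\<close>; every
  increase of \<open>N\<close> costs a linear factor.\<close>

lemma mellin_B_Suc: "poly (mellin \<gamma> (Suc k) (B k)) s = (s + \<gamma> + 2 + real k) * C k * poly (Z k) s"
  by (simp add: mellin_Suc degree_B mellin_B algebra_simps)

lemma mellin_B_Suc2:
  "poly (mellin \<gamma> (Suc (Suc k)) (B k)) s
    = (s + \<gamma> + 3 + real k) * (s + \<gamma> + 2 + real k) * C k * poly (Z k) s"
  by (simp add: mellin_Suc degree_B mellin_B algebra_simps)

lemma mellin_B_Suc3:
  "poly (mellin \<gamma> (Suc (Suc (Suc k))) (B k)) s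
    = (s + \<gamma> + 4 + real k) * (s + \<gamma> + 3 + real k) * (s + \<gamma> + 2 + real k) * C k * poly (Z k) s"
  by (simp add: mellin_Suc degree_B mellin_B algebra_simps)

lemma eqI_mellin:
  assumes "degree p \<le> N" "degree p' \<le> N"
    and "\<And>s. poly (mellin \<gamma> N p) s = poly (mellin \<gamma> N p') s"
  shows "p = p'"
proof -
  have "poly (mellin \<gamma> N p) = poly (mellin \<gamma> N p')" using assms(3) by (rule ext)
  then have "mellin \<gamma> N (p - p') = 0" by (simp add: poly_eq_poly_eq_iff mellin_diff)
  then have "p - p' = 0"
    by (rule mellin_eq_0[OF gt(3) degree_diff_le[OF assms(1,2)]])
  then show ?thesis by simp
qed

text \<open>The basis is triangular with unit diagonal: at the largest index where \<open>c\<close>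
  and \<open>c'\<close> differ, smaller indices contribute nothing to the coefficient of that
  degree.\<close>

lemma B_expansion_unique:
  assumes "finite {l. c l \<noteq> 0}" "finite {l. c' l \<noteq> 0}"
    and "(\<Sum>l | c l \<noteq> 0. smult (c l) (B l)) = (\<Sum>l | c' l \<noteq> 0. smult (c' l) (B l))"
  shows "c = c'"
proof (rule ccontr)
  assume "c \<noteq> c'"
  define S where "S = {l. c l \<noteq> 0} \<union> {l. c' l \<noteq> 0}"
  define T where "T = {l. c l \<noteq> c' l}"
  have T: "finite T" "T \<noteq> {}" "T \<subseteq> S" "finite S"
    using assms(1,2) \<open>c \<noteq> c'\<close> by (auto simp: T_def S_def intro: finite_subset[of _ S])
  have "(\<Sum>l\<in>S. smult (c l) (B l)) = (\<Sum>l | c l \<noteq> 0. smult (c l) (B l))"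
    "(\<Sum>l\<in>S. smult (c' l) (B l)) = (\<Sum>l | c' l \<noteq> 0. smult (c' l) (B l))"
    using T(4) by (auto intro!: sum.mono_neutral_right simp: S_def)
  then have "(\<Sum>l\<in>S. smult (c l - c' l) (B l)) = 0"
    using assms(3) by (simp add: smult_diff_left sum_subtractf)
  then have "coeff (\<Sum>l\<in>S. smult (c l - c' l) (B l)) (Max T) = 0" by (simp only: coeff_0)
  then have "(\<Sum>l\<in>S. (c l - c' l) * coeff (B l) (Max T)) = 0" by (simp only: coeff_sum coeff_smult)
  moreover have "(\<Sum>l\<in>S. (c l - c' l) * coeff (B l) (Max T))
    = (\<Sum>l\<in>{Max T}. (c l - c' l) * coeff (B l) (Max T))"
  proof (rule sum.mono_neutral_right)
    show "finite S" "{Max T} \<subseteq> S" using T(3,4) Max_in[OF T(1,2)] by blast+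
    show "\<forall>l\<in>S - {Max T}. (c l - c' l) * coeff (B l) (Max T) = 0"
    proof
      fix l assume l: "l \<in> S - {Max T}"
      show "(c l - c' l) * coeff (B l) (Max T) = 0"
      proof (cases "l \<in> T")
        case True
        then have "l < Max T" using l Max_ge[OF T(1) True] by (simp add: less_le)
        then show ?thesis by (simp add: coeff_eq_0 degree_B)
      qed (simp add: T_def)
    qed
  qed
  ultimately have "c (Max T) = c' (Max T)" by (simp add: coeff_B)
  then show False using Max_in[OF T(1,2)] by (simp add: T_def)
qed

section \<open>The first two rows of the matrix\<close>

text \<open>The identity is linear in \<open>s\<close> here, and \<open>s = \<alpha>\<close>
  determines \<open>b\<close>.\<close>

lemma recurrence_0:
  defines "b \<equiv> (\<alpha> + 1) / (\<alpha> + \<gamma> + 2)"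
  shows "[:0, 1:] * B 0 = B (Suc 0) + smult b (B 0)"
proof (rule eqI_mellin[of _ "Suc 0"])
  show "degree ([:0, 1:] * B 0) \<le> Suc 0" by (rule order.trans[OF degree_mult_le]) (simp add: degree_B)
  show "degree (B (Suc 0) + smult b (B 0)) \<le> Suc 0"
    by (intro degree_add_le order.trans[OF degree_smult_le]) (simp_all add: degree_B)
  have pos: "\<alpha> + \<gamma> + 2 > 0" using gt by linarith
  have C: "C 0 = 1" "C (Suc 0) = (\<gamma> + 1) / (\<gamma> + 2 + \<alpha>)" by (simp_all add: C_def)
  show "poly (mellin \<gamma> (Suc 0) ([:0, 1:] * B 0)) s = poly (mellin \<gamma> (Suc 0) (B (Suc 0) + smult b (B 0))) s" for s
  proof -
    have "s + 1 = ((\<gamma> + 1) * (s - \<alpha>) + (\<alpha> + 1) * (s + \<gamma> + 2)) / (\<alpha> + \<gamma> + 2)"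
      using pos by (simp add: eq_divide_eq) algebra
    moreover have "\<gamma> + 2 + \<alpha> = \<alpha> + \<gamma> + 2" by simp
    ultimately have "s + 1 = C (Suc 0) * (s - \<alpha>) + b * (s + \<gamma> + 2)"
      by (simp only: C b_def add_divide_distrib[of "(\<gamma> + 1) * (s - \<alpha>)"] times_divide_eq_left)
    then show ?thesis
      unfolding poly_mellin_X_B mellin_add mellin_smult poly_add poly_smult mellin_B_Suc mellin_B
      by (simp add: poly_Z C(1))
  qed
qed

text \<open>Here the identity is quadratic. The node \<alpha> determines \<open>c\<close>, the node
  \<open>- t - 2\<close> determines \<open>R\<close>, and then \<open>- t - 1\<close> determines
  \<open>b\<close>.\<close>

lemma recurrence_1:
  obtains b c where "0 \<le> b" "0 \<le> c"
    "[:0, 1:] * B (Suc 0) = B (Suc (Suc 0)) + smult b (B (Suc 0)) + smult c (B 0)"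
proof -
  define t where "t = \<gamma> + 1"
  have t: "t > 0" unfolding t_def using gt by simp
  have pos: "t + 1 + \<alpha> > 0" "t + 2 + \<alpha> > 0" "t + 2 + \<beta> > 0" using t gt by linarith+
  define R where "R = (t + 1) * (t + 1 + \<alpha>) / ((t + 2 + \<alpha>) * (t + 2 + \<beta>))"
  define b where "b = R * (t + 1 + \<beta>) - t * (t + \<alpha>) / (t + 1 + \<alpha>)"
  define c where "c = (\<alpha> + 1) / ((t + 2 + \<alpha>) * (t + 1 + \<alpha>))"
  have c: "0 \<le> c" unfolding c_def using pos gt by simp
  \<comment> \<open>This is \<open>0 \<le> b\<close> with denominators cleared. The cases arise
    because \<open>t + \<alpha>\<close> may be negative.\<close>
  have "t * (t + \<alpha>) * ((t + 2 + \<alpha>) * (t + 2 + \<beta>)) \<le> (t + 1) * (t + 1 + \<alpha>) * (t + 1 + \<beta>) * (t + 1 + \<alpha>)"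
  proof (cases "t + \<alpha> \<le> 0")
    case True
    then have "t * (t + \<alpha>) * ((t + 2 + \<alpha>) * (t + 2 + \<beta>)) \<le> 0"
      using t pos by (simp add: mult_le_0_iff)
    also have "0 \<le> (t + 1) * (t + 1 + \<alpha>) * (t + 1 + \<beta>) * (t + 1 + \<alpha>)"
      using t pos gt by simp
    finally show ?thesis .
  next
    case False
    have "(t * (t + 2 + \<beta>)) * ((t + \<alpha>) * (t + 2 + \<alpha>)) \<le> ((t + 1) * (t + 1 + \<beta>)) * ((t + 1 + \<alpha>) * (t + 1 + \<alpha>))"
    proof (rule mult_mono)
      show "t * (t + 2 + \<beta>) \<le> (t + 1) * (t + 1 + \<beta>)" using gt by (simp add: algebra_simps)
      show "(t + \<alpha>) * (t + 2 + \<alpha>) \<le> (t + 1 + \<alpha>) * (t + 1 + \<alpha>)" by (simp add: algebra_simps)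
      show "0 \<le> (t + 1) * (t + 1 + \<beta>)" using t gt by simp
      show "0 \<le> (t + \<alpha>) * (t + 2 + \<alpha>)" using False pos by simp
    qed
    then show ?thesis by (simp only: mult_ac)
  qed
  then have b: "0 \<le> b"
    unfolding b_def R_def using pos by (simp add: divide_le_eq le_divide_eq mult_ac)
  have expansion: "(s + 1) * (s + 1 - \<alpha>) = R * ((s - \<alpha>) * (s - \<beta>)) + b * ((s - \<alpha>) * (s + t + 2))
    + c * ((s + t + 1) * (s + t + 2))" for s
  proof -
    define W where "W = [:1, 1:] * [:1 - \<alpha>, 1:]"
    define V where "V = smult R ([:-\<alpha>,1:] * [:-\<beta>,1:]) + smult b ([:-\<alpha>,1:] * [:t + 2,1:])
      + smult c ([:t + 1,1:] * [:t + 2,1:])"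
    have deg: "degree ([:x,1:] * [:y,1:] :: real poly) \<le> 2" for x y by (simp add: degree_mult_eq)
    have pV: "poly V s = R * ((s - \<alpha>) * (s - \<beta>)) + b * ((s - \<alpha>) * (s + t + 2))
      + c * ((s + t + 1) * (s + t + 2))" for s unfolding V_def by (simp add: algebra_simps)
    have pW: "poly W s = (s + 1) * (s + 1 - \<alpha>)" for s unfolding W_def by (simp add: algebra_simps)
    have "W = V"
    proof (rule poly_eqI_degree[where A = "{\<alpha>, - t - 1, - t - 2}"])
      have "card {\<alpha>, - t - 1, - t - 2} = 3" using pos by simp
      moreover have "degree W \<le> 2" "degree V \<le> 2" unfolding W_def V_def
        by (intro degree_add_le order.trans[OF degree_smult_le] deg)+
      ultimately show "degree W < card {\<alpha>, - t - 1, - t - 2}" "degree V < card {\<alpha>, - t - 1, - t - 2}" by simp_all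
      have "c * ((t + 2 + \<alpha>) * (t + 1 + \<alpha>)) = \<alpha> + 1" unfolding c_def using pos by simp
      then have 1: "poly W \<alpha> = poly V \<alpha>" unfolding pV pW by (simp add: algebra_simps)
      have "b * (t + 1 + \<alpha>) = R * (t + 1 + \<beta>) * (t + 1 + \<alpha>) - t * (t + \<alpha>)"
        unfolding b_def using pos by (simp add: left_diff_distrib)
      then have 2: "poly W (- t - 1) = poly V (- t - 1)" unfolding pV pW by (simp add: algebra_simps)
      have "R * ((t + 2 + \<alpha>) * (t + 2 + \<beta>)) = (t + 1) * (t + 1 + \<alpha>)" unfolding R_def using pos by simp
      then have 3: "poly W (- t - 2) = poly V (- t - 2)" unfolding pV pW by (simp add: algebra_simps)
      show "poly W x = poly V x" if "x \<in> {\<alpha>, - t - 1, - t - 2}" for x using that 1 2 3 by blast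
    qed
    then show ?thesis using pV pW by metis
  qed
  have C: "C 0 = 1" "C (Suc (Suc 0)) = R * C (Suc 0)"
    using pos by (simp_all add: C_def R_def t_def lessThan_Suc add_ac mult_ac)
  have "[:0, 1:] * B (Suc 0) = B (Suc (Suc 0)) + smult b (B (Suc 0)) + smult (c * C (Suc 0)) (B 0)"
  proof (rule eqI_mellin[of _ "Suc (Suc 0)"])
    show "degree ([:0, 1:] * B (Suc 0)) \<le> Suc (Suc 0)"
      by (rule order.trans[OF degree_mult_le]) (simp add: degree_B)
    show "degree (B (Suc (Suc 0)) + smult b (B (Suc 0)) + smult (c * C (Suc 0)) (B 0)) \<le> Suc (Suc 0)"
      by (intro degree_add_le order.trans[OF degree_smult_le]) (simp_all add: degree_B)
    fix s
    have "poly (mellin \<gamma> (Suc (Suc 0)) ([:0, 1:] * B (Suc 0))) s = C (Suc 0) * ((s + 1) * (s + 1 - \<alpha>))"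
      unfolding poly_mellin_X_B by (simp add: poly_Z)
    also have "\<dots> = poly (mellin \<gamma> (Suc (Suc 0)) (B (Suc (Suc 0)) + smult b (B (Suc 0)) + smult (c * C (Suc 0)) (B 0))) s"
      unfolding expansion mellin_add mellin_smult poly_add poly_smult mellin_B_Suc mellin_B_Suc2 mellin_B
      by (simp add: poly_Z C t_def algebra_simps)
    finally show "poly (mellin \<gamma> (Suc (Suc 0)) ([:0, 1:] * B (Suc 0))) s
      = poly (mellin \<gamma> (Suc (Suc 0)) (B (Suc (Suc 0)) + smult b (B (Suc 0)) + smult (c * C (Suc 0)) (B 0))) s" .
  qed
  moreover have "0 \<le> c * C (Suc 0)" using c C_pos[of "Suc 0"] by simp
  ultimately show thesis using that b by blast
qed

lemma z_even_odd: "z (2 * j) = \<alpha> + real j" "z (Suc (2 * j)) = \<beta> + real j"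
  by (simp_all add: z_def)

end

section \<open>The sign of the second subdiagonal-type numerator in the two parities\<close>

text \<open>An instance of \<open>even_rising_ratio\<close> with
  \<open>d = q - p = \<beta> - \<alpha>\<close>, where a factor \<open>n\<close> common to both
  sides is restored.\<close>

lemma even_step_comparison:
  fixes \<alpha> \<beta> \<gamma> n :: real
  assumes gt: "\<alpha> > -1" "\<gamma> > -1" and n: "1 \<le> n" and le: "\<alpha> \<le> \<beta>" "\<beta> < \<alpha> + 1"
    and p: "p = \<alpha> + n - 1" and q: "q = \<beta> + n - 1" and t: "t = \<gamma> + 2 * n"
  shows "(p + 1) * (p + 1 - \<alpha>) * (p + 1 - \<beta>) * ((q + t) * (q + t + 1) * (q + t + 2))
    \<le> (q + 1) * (q + 1 - \<alpha>) * (q + 1 - \<beta>) * ((p + t) * (p + t + 1) * (p + t + 2))"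
proof -
  have "(p + 1) * (n - (q - p)) * ((p + t + (q - p)) * (p + t + 1 + (q - p)) * (p + t + 2 + (q - p)))
    \<le> (p + 1 + (q - p)) * (n + (q - p)) * ((p + t) * (p + t + 1) * (p + t + 2))"
    using assms by (intro even_rising_ratio) auto
  moreover have "n - (q - p) = p + 1 - \<beta>" "n + (q - p) = q + 1 - \<alpha>"
    "p + t + (q - p) = q + t" "p + t + 1 + (q - p) = q + t + 1" "p + t + 2 + (q - p) = q + t + 2"
    "p + 1 + (q - p) = q + 1"
    unfolding p q by simp_all
  ultimately have "(p + 1) * (p + 1 - \<beta>) * ((q + t) * (q + t + 1) * (q + t + 2))
    \<le> (q + 1) * (q + 1 - \<alpha>) * ((p + t) * (p + t + 1) * (p + t + 2))"
    by (simp only:)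
  then have "n * ((p + 1) * (p + 1 - \<beta>) * ((q + t) * (q + t + 1) * (q + t + 2)))
    \<le> n * ((q + 1) * (q + 1 - \<alpha>) * ((p + t) * (p + t + 1) * (p + t + 2)))"
    using n by (intro mult_left_mono) auto
  moreover have "p + 1 - \<alpha> = n" "q + 1 - \<beta> = n" unfolding p q by simp_all
  ultimately show ?thesis by (simp only: mult_ac)
qed

text \<open>An instance of \<open>odd_rising_ratio\<close> with
  \<open>e = q - p = \<alpha> - \<beta> + 1\<close>, which lies strictly between 0 and 2.\<close>

lemma odd_step_comparison:
  fixes \<alpha> \<beta> \<gamma> n :: real
  assumes gt: "\<beta> > -1" "\<gamma> > -1" and n: "1 \<le> n" and abs: "\<bar>\<alpha> - \<beta>\<bar> < 1"
    and p: "p = \<beta> + n - 1" and q: "q = \<alpha> + n" and t: "t = \<gamma> + 2 * n + 1"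
  shows "(p + 1) * (p + 1 - \<alpha>) * (p + 1 - \<beta>) * ((q + t) * (q + t + 1) * (q + t + 2))
    \<le> (q + 1) * (q + 1 - \<alpha>) * (q + 1 - \<beta>) * ((p + t) * (p + t + 1) * (p + t + 2))"
proof -
  have "(p + 1) * (n * (n + 1 - (q - p))) * ((p + t + (q - p)) * (p + t + 1 + (q - p)) * (p + t + 2 + (q - p)))
    \<le> (p + 1 + (q - p)) * ((n + 1) * (n + (q - p))) * ((p + t) * (p + t + 1) * (p + t + 2))"
    using assms by (intro odd_rising_ratio) auto
  moreover have "n + 1 - (q - p) = p + 1 - \<alpha>" "n + (q - p) = q + 1 - \<beta>"
    "p + t + (q - p) = q + t" "p + t + 1 + (q - p) = q + t + 1" "p + t + 2 + (q - p) = q + t + 2"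
    "p + 1 + (q - p) = q + 1"
    unfolding p q by simp_all
  ultimately have "(p + 1) * (n * (p + 1 - \<alpha>)) * ((q + t) * (q + t + 1) * (q + t + 2))
    \<le> (q + 1) * ((n + 1) * (q + 1 - \<beta>)) * ((p + t) * (p + t + 1) * (p + t + 2))"
    by (simp only:)
  moreover have "p + 1 - \<beta> = n" "q + 1 - \<alpha> = n + 1" unfolding p q by simp_all
  ultimately show ?thesis by (simp only: mult_ac)
qed

section \<open>The general recurrence and the entries of the Jacobi matrix\<close>

context jp_params begin

text \<open>After transformation every term contains \<open>poly (Z m) s\<close>; what remains is
  the cubic identity of \<open>cubic_expansion_nonneg\<close>.\<close>

lemma recurrence_Suc_Suc:
  assumes abs: "\<bar>\<alpha> - \<beta>\<bar> < 1"
  obtains b c d where "0 \<le> b" "0 \<le> c" "0 \<le> d"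
    "[:0, 1:] * B (Suc (Suc m)) = B (Suc (Suc (Suc m))) + smult b (B (Suc (Suc m)))
      + smult c (B (Suc m)) + smult d (B m)"
proof -
  define p where "p = z m"
  define q where "q = z (Suc m)"
  define t where "t = \<gamma> + 2 + real m"
  define R where "R = C (Suc (Suc (Suc m))) / C (Suc (Suc m))"
  have C_nz: "C k \<noteq> 0" for k using C_pos[of k] by simp
  have t: "t > 1" unfolding t_def using gt by simp
  have pq: "p > -1" "q > -1" "p \<noteq> q"
    unfolding p_def q_def using z_gt injD[OF inj_z, of m "Suc m"] by auto
  have Z: "poly (Z (Suc (Suc m))) s = (s - p) * (s - q) * poly (Z m) s"
    "poly (Z (Suc (Suc (Suc m)))) s = (s - p) * (s - q) * (s - (p + 1)) * poly (Z m) s"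
    "poly (Z (Suc m)) s = (s - p) * poly (Z m) s" for s
    by (simp_all add: poly_Z p_def q_def mult_ac)
  \<comment> \<open>Cancelling \<open>Z m\<close> from \<open>C_Suc\<close> at
    \<open>- t - 2\<close> yields the equation for \<open>R\<close>.\<close>
  have "C (Suc (Suc (Suc m))) * poly (Z (Suc (Suc (Suc m)))) (- t - 2)
    = (- t - 1) * C (Suc (Suc m)) * poly (Z (Suc (Suc m))) (- t - 2 + 1)"
    using C_Suc[of "Suc (Suc m)"] by (simp add: t_def algebra_simps)
  then have "(C (Suc (Suc (Suc m))) * ((- t - 2 - p) * (- t - 2 - q) * (- t - 2 - (p + 1)))) * poly (Z m) (- t - 2)
    = (C (Suc (Suc m)) * ((- t - 1) * (- t - 2 + 1 - \<alpha>) * (- t - 2 + 1 - \<beta>))) * poly (Z m) (- t - 2)"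
    unfolding Z(2) poly_Z_shift by (simp only: mult_ac)
  moreover have "poly (Z m) (- t - 2) \<noteq> 0" using Z_neg_nonzero[of "- t - 2"] t by simp
  ultimately have "C (Suc (Suc (Suc m))) * ((- t - 2 - p) * (- t - 2 - q) * (- t - 2 - (p + 1)))
    = C (Suc (Suc m)) * ((- t - 1) * (- t - 2 + 1 - \<alpha>) * (- t - 2 + 1 - \<beta>))"
    by (simp only: mult_cancel_right simp_thms)
  then have "R * ((- t - 2 - p) * (- t - 2 - q) * (- t - 2 - (p + 1)))
    = (- t - 1) * (- t - 2 + 1 - \<alpha>) * (- t - 2 + 1 - \<beta>)"
    using C_nz[of "Suc (Suc m)"] unfolding R_def by (simp add: divide_eq_eq mult.commute)
  moreover have "(- t - 2 - p) * (- t - 2 - q) * (- t - 2 - (p + 1)) = - ((t + 2 + p) * (t + 2 + q) * (t + 3 + p))"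
    "(- t - 1) * (- t - 2 + 1 - \<alpha>) * (- t - 2 + 1 - \<beta>) = - ((t + 1) * (t + 1 + \<alpha>) * (t + 1 + \<beta>))"
    by algebra+
  ultimately have R: "(t + 1) * (t + 1 + \<alpha>) * (t + 1 + \<beta>) = R * ((t + 2 + p) * (t + 2 + q) * (t + 3 + p))"
    by simp
  have sign: "0 \<le> (p + 1) * (p + 1 - \<alpha>) * (p + 1 - \<beta>)"
    "0 \<le> (q - p) * ((q + 1) * (q + 1 - \<alpha>) * (q + 1 - \<beta>) * ((p + t) * (p + t + 1) * (p + t + 2))
      - (p + 1) * (p + 1 - \<alpha>) * (p + 1 - \<beta>) * ((q + t) * (q + t + 1) * (q + t + 2)))"
    "t * (t + \<alpha>) * (t + \<beta>) / ((t + 1 + p) * (t + 1 + q))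
      \<le> (t + 1) * (t + 1 + \<alpha>) * (t + 1 + \<beta>) / ((t + 3 + p) * (t + 2 + q))"
  proof -
    \<comment> \<open>For even \<open>m\<close>, \<open>p\<close> comes from \<alpha> and
      \<open>q - p = \<beta> - \<alpha>\<close> has either sign; for odd \<open>m\<close>,
      \<open>p\<close> comes from \<beta> and \<open>q - p = \<alpha> - \<beta> + 1\<close> is
      positive.\<close>
    consider j where "m = 2 * j" | j where "m = Suc (2 * j)" by (metis evenE oddE Suc_eq_plus1)
    then have "0 \<le> (p + 1) * (p + 1 - \<alpha>) * (p + 1 - \<beta>) \<and>
      0 \<le> (q - p) * ((q + 1) * (q + 1 - \<alpha>) * (q + 1 - \<beta>) * ((p + t) * (p + t + 1) * (p + t + 2))
        - (p + 1) * (p + 1 - \<alpha>) * (p + 1 - \<beta>) * ((q + t) * (q + t + 1) * (q + t + 2))) \<and>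
      t * (t + \<alpha>) * (t + \<beta>) / ((t + 1 + p) * (t + 1 + q))
        \<le> (t + 1) * (t + 1 + \<alpha>) * (t + 1 + \<beta>) / ((t + 3 + p) * (t + 2 + q))"
    proof cases
      case (1 j)
      define n where "n = real j + 1"
      have n: "1 \<le> n" "p = \<alpha> + n - 1" "q = \<beta> + n - 1" "t = \<gamma> + 2 * n"
        unfolding p_def q_def t_def 1 n_def z_even_odd by simp_all
      \<comment> \<open>The last factor is \<open>\<alpha> - \<beta> + n\<close>; for
        \<open>n = 1\<close> its sign rests on \<open>abs\<close>.\<close>
      have "0 \<le> (p + 1) * (p + 1 - \<alpha>) * (p + 1 - \<beta>)"
        using n abs pq by (intro mult_nonneg_nonneg) auto
      moreover have "0 \<le> (q - p) * ((q + 1) * (q + 1 - \<alpha>) * (q + 1 - \<beta>) * ((p + t) * (p + t + 1) * (p + t + 2))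
        - (p + 1) * (p + 1 - \<alpha>) * (p + 1 - \<beta>) * ((q + t) * (q + t + 1) * (q + t + 2)))"
      proof (cases "\<alpha> \<le> \<beta>")
        case True
        then show ?thesis
          using even_step_comparison[OF gt(1,3) n(1) True _ n(2-4)] abs n by (intro mult_nonneg_nonneg) auto
      next
        case False
        \<comment> \<open>The comparison with the two parameters exchanged; now both factors of the
          goal are nonpositive.\<close>
        then have "(q + 1) * (q + 1 - \<beta>) * (q + 1 - \<alpha>) * ((p + t) * (p + t + 1) * (p + t + 2))
          \<le> (p + 1) * (p + 1 - \<beta>) * (p + 1 - \<alpha>) * ((q + t) * (q + t + 1) * (q + t + 2))"
          using abs by (intro even_step_comparison[OF gt(2,3) n(1) _ _ n(3,2,4)]) auto
        then show ?thesis using False n by (intro mult_nonpos_nonpos) (auto simp: mult_ac)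
      qed
      moreover have "t * (t + \<alpha>) * (t + \<beta>) / ((t + 1 + p) * (t + 1 + q))
        \<le> (t + 1) * (t + 1 + \<alpha>) * (t + 1 + \<beta>) / ((t + 3 + p) * (t + 2 + q))"
        by (rule diagonal_ratio) (use t n gt in auto)
      ultimately show ?thesis by blast
    next
      case (2 j)
      define n where "n = real j + 1"
      have n: "1 \<le> n" "p = \<beta> + n - 1" "q = \<alpha> + n" "t = \<gamma> + 2 * n + 1"
        unfolding p_def q_def t_def 2 n_def z_even_odd z_simps by simp_all
      have "0 \<le> (p + 1) * (p + 1 - \<alpha>) * (p + 1 - \<beta>)"
        using n abs pq by (intro mult_nonneg_nonneg) auto
      moreover have "0 \<le> (q - p) * ((q + 1) * (q + 1 - \<alpha>) * (q + 1 - \<beta>) * ((p + t) * (p + t + 1) * (p + t + 2))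
        - (p + 1) * (p + 1 - \<alpha>) * (p + 1 - \<beta>) * ((q + t) * (q + t + 1) * (q + t + 2)))"
        using odd_step_comparison[OF gt(2,3) n(1) abs n(2-4)] abs n by (intro mult_nonneg_nonneg) auto
      \<comment> \<open>The exchanged order pairs each parameter with the node of its own
        family.\<close>
      moreover have "t * (t + \<beta>) * (t + \<alpha>) / ((t + 1 + p) * (t + 1 + q))
        \<le> (t + 1) * (t + 1 + \<beta>) * (t + 1 + \<alpha>) / ((t + 3 + p) * (t + 2 + q))"
        by (rule diagonal_ratio) (use t n gt in auto)
      then have "t * (t + \<alpha>) * (t + \<beta>) / ((t + 1 + p) * (t + 1 + q))
        \<le> (t + 1) * (t + 1 + \<alpha>) * (t + 1 + \<beta>) / ((t + 3 + p) * (t + 2 + q))"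
        by (simp only: mult_ac)
      ultimately show ?thesis by blast
    qed
    then show "0 \<le> (p + 1) * (p + 1 - \<alpha>) * (p + 1 - \<beta>)"
      "0 \<le> (q - p) * ((q + 1) * (q + 1 - \<alpha>) * (q + 1 - \<beta>) * ((p + t) * (p + t + 1) * (p + t + 2))
        - (p + 1) * (p + 1 - \<alpha>) * (p + 1 - \<beta>) * ((q + t) * (q + t + 1) * (q + t + 2)))"
      "t * (t + \<alpha>) * (t + \<beta>) / ((t + 1 + p) * (t + 1 + q))
        \<le> (t + 1) * (t + 1 + \<alpha>) * (t + 1 + \<beta>) / ((t + 3 + p) * (t + 2 + q))"
      by blast+
  qed
  obtain b c d where nonneg: "0 \<le> b" "0 \<le> c" "0 \<le> d"
    and expansion: "\<And>s. (s + 1) * (s + 1 - \<alpha>) * (s + 1 - \<beta>) = R * ((s - p) * (s - q) * (s - (p + 1)))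
      + b * ((s - p) * (s - q) * (s + t + 2)) + c * ((s - p) * (s + t + 2) * (s + t + 1))
      + d * ((s + t + 2) * (s + t + 1) * (s + t))"
    using cubic_expansion_nonneg[OF t pq R sign] by metis
  let ?K = "C (Suc (Suc m))"
  \<comment> \<open>The rescaling accounts for the different constants \<open>C\<close> in the
    transforms of the basis polynomials.\<close>
  define c' where "c' = c * ?K / C (Suc m)"
  define d' where "d' = d * ?K / C m"
  have CR: "C (Suc (Suc (Suc m))) = ?K * R" "c' * C (Suc m) = ?K * c" "d' * C m = ?K * d"
    using C_nz by (simp_all add: R_def c'_def d'_def)
  have nonneg': "0 \<le> c'" "0 \<le> d'"
    unfolding c'_def d'_def using nonneg C_pos by (simp_all add: less_imp_le)
  let ?S = "B (Suc (Suc (Suc m))) + smult b (B (Suc (Suc m))) + smult c' (B (Suc m)) + smult d' (B m)"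
  have "[:0, 1:] * B (Suc (Suc m)) = ?S"
  proof (rule eqI_mellin[of _ "Suc (Suc (Suc m))"])
    show "degree ([:0, 1:] * B (Suc (Suc m))) \<le> Suc (Suc (Suc m))"
      by (rule order.trans[OF degree_mult_le]) (simp add: degree_B)
    show "degree ?S \<le> Suc (Suc (Suc m))"
      by (intro degree_add_le order.trans[OF degree_smult_le]) (simp_all add: degree_B)
    fix s
    have "poly (mellin \<gamma> (Suc (Suc (Suc m))) ?S) s
      = C (Suc (Suc (Suc m))) * poly (Z (Suc (Suc (Suc m)))) s
        + b * ((s + t + 2) * ?K * poly (Z (Suc (Suc m))) s)
        + (c' * C (Suc m)) * ((s + t + 2) * (s + t + 1) * poly (Z (Suc m)) s)
        + (d' * C m) * ((s + t + 2) * (s + t + 1) * (s + t) * poly (Z m) s)"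
      unfolding mellin_add mellin_smult poly_add poly_smult mellin_B_Suc mellin_B_Suc2 mellin_B_Suc3 mellin_B t_def
      by (simp add: add_ac mult_ac)
    also have "\<dots> = ?K * poly (Z m) s * (R * ((s - p) * (s - q) * (s - (p + 1)))
      + b * ((s - p) * (s - q) * (s + t + 2)) + c * ((s - p) * (s + t + 2) * (s + t + 1))
      + d * ((s + t + 2) * (s + t + 1) * (s + t)))"
      unfolding CR Z by algebra
    also have "\<dots> = (s + 1) * ?K * poly (Z (Suc (Suc m))) (s + 1)"
      unfolding expansion[symmetric] poly_Z_shift by (simp only: mult_ac)
    finally show "poly (mellin \<gamma> (Suc (Suc (Suc m))) ([:0, 1:] * B (Suc (Suc m)))) s
      = poly (mellin \<gamma> (Suc (Suc (Suc m))) ?S) s"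
      unfolding poly_mellin_X_B by simp
  qed
  then show thesis using that nonneg(1) nonneg' by blast
qed

lemma nonneg_expansion:
  assumes abs: "\<bar>\<alpha> - \<beta>\<bar> < 1"
  obtains f where "\<forall>l. 0 \<le> f l" "\<forall>l>Suc k. f l = 0"
    "[:0, 1:] * B k = (\<Sum>l\<le>Suc k. smult (f l) (B l))"
proof -
  consider "k = 0" | "k = Suc 0" | m where "k = Suc (Suc m)" by (metis not0_implies_Suc)
  then show thesis
  proof cases
    case 1
    define f where "f l = (if l = 0 then (\<alpha> + 1) / (\<alpha> + \<gamma> + 2) else if l = 1 then 1 else 0)" for l :: nat
    show thesis
      by (rule that[of f]) (use gt recurrence_0 in \<open>auto simp: 1 f_def\<close>)
  next
    case 2
    obtain b c where "0 \<le> b" "0 \<le> c"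
      "[:0, 1:] * B (Suc 0) = B (Suc (Suc 0)) + smult b (B (Suc 0)) + smult c (B 0)"
      by (rule recurrence_1)
    then show thesis
      by (intro that[of "\<lambda>l. if l = 0 then c else if l = 1 then b else if l = 2 then 1 else 0"])
        (auto simp: 2 numeral_2_eq_2)
  next
    case (3 m)
    obtain b c d where rec: "0 \<le> b" "0 \<le> c" "0 \<le> d"
      "[:0, 1:] * B (Suc (Suc m)) = B (Suc (Suc (Suc m))) + smult b (B (Suc (Suc m)))
        + smult c (B (Suc m)) + smult d (B m)"
      by (rule recurrence_Suc_Suc[OF abs])
    define f where "f l = (if l = m then d else if l = Suc m then c else if l = Suc (Suc m) then b
      else if l = Suc (Suc (Suc m)) then 1 else 0)" for l
    \<comment> \<open>The band structure: \<open>f\<close> vanishes below \<open>m\<close>.\<close>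
    have "(\<Sum>l\<le>m. smult (f l) (B l)) = (\<Sum>l\<in>{m}. smult (f l) (B l))"
      by (rule sum.mono_neutral_right) (auto simp: f_def)
    then have "(\<Sum>l\<le>Suc k. smult (f l) (B l)) = [:0, 1:] * B k"
      unfolding 3 rec by (simp add: f_def)
    then show thesis by (intro that[of f]) (auto simp: f_def 3 rec(1-3))
  qed
qed

lemma jp_jacobi_matrix_nonneg:
  assumes abs: "\<bar>\<alpha> - \<beta>\<bar> < 1"
  shows "0 \<le> jp_jacobi_matrix \<alpha> \<beta> \<gamma> k l"
proof -
  obtain f where f: "\<forall>l. 0 \<le> f l" "\<forall>l>Suc k. f l = 0"
    "[:0, 1:] * B k = (\<Sum>l\<le>Suc k. smult (f l) (B l))"
    by (rule nonneg_expansion[OF abs, of k])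
  have sub: "{l. f l \<noteq> 0} \<subseteq> {..Suc k}" using f(2) by (auto simp: not_le[symmetric])
  then have fin: "finite {l. f l \<noteq> 0}" by (rule finite_subset) simp
  have exp: "[:0, 1:] * B k = (\<Sum>l | f l \<noteq> 0. smult (f l) (B l))"
    unfolding f(3) using sub by (intro sum.mono_neutral_right) auto
  have "jp_jacobi_matrix \<alpha> \<beta> \<gamma> k = f"
    unfolding jp_jacobi_matrix_def
  proof (rule the_equality)
    show "finite {l. f l \<noteq> 0} \<and> [:0, 1:] * B k = (\<Sum>l | f l \<noteq> 0. smult (f l) (B l))"
      using fin exp by blast
    show "c = f" if "finite {l. c l \<noteq> 0} \<and> [:0, 1:] * B k = (\<Sum>l | c l \<noteq> 0. smult (c l) (B l))" for c
      using that fin exp by (intro B_expansion_unique) simp_all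
  qed
  then show ?thesis using f(1) by simp
qed

end

theorem theorem10:
  fixes \<alpha> \<beta> \<gamma> :: real
  assumes "\<alpha> > -1" and "\<beta> > -1" and "\<gamma> > -1"
    and "\<alpha> - \<beta> \<notin> \<int>"
    and "\<bar>\<alpha> - \<beta>\<bar> < 1"
  shows "\<forall>k l. jp_jacobi_matrix \<alpha> \<beta> \<gamma> k l \<ge> 0"
proof -
  interpret jp_params \<alpha> \<beta> \<gamma> by unfold_locales (use assms in auto)
  show ?thesis using jp_jacobi_matrix_nonneg[OF assms(5)] by blast
qed

end
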